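(* For each period $p\in\mathcal P$ of the bus fleet electrification problem defined in the context, with operational value function $\mathcal Q_p:\mathcal X_p\to[0,+\infty]$, let $LBBD_p$ be the set of all $(x_p,\Theta_p)\in\mathcal X_p\times\mathbb R_+$ such that $$\Theta_p\ \ge\ \mathcal Q_p(x'_p)\,\mathbf 1\{x_p\preceq x'_p\}\qquad\text{for all }x'_p\in\mathcal X_p\text{ with }\mathcal Q_p(x'_p)<+\infty,$$ $$\mathbf 1\{x_p\preceq x'_p\}=0\qquad\text{for all }x'_p\in\mathcal X_p\text{ with }\mathcal Q_p(x'_p)=+\infty.$$ Then $LBBD_p$ is equal to the epigraph $$\mathrm{epi}(\mathcal Q_p)=\{(x_p,\Theta_p)\in\mathcal X_p\times\mathbb R_+:\ \mathcal Q_p(x_p)\le\Theta_p\}.$$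
   Context: **Data.** Finite sets: investment periods $\mathcal P=\{1,\dots,P\}$, routes $\mathcal R$, depot battery-electric-bus (BEB) types $\mathcal B$, depots $\mathcal I$, terminals $\mathcal J$, and time intervals $\mathcal T=\{0,\dots,T-1\}$ viewed as residues modulo $T$ (all time indices are taken modulo $T$). Each route $r$ has a set $\mathcal J(r)\subseteq\mathcal J$ of connected terminals; $\mathcal R(j)=\{r\in\mathcal R: j\in\mathcal J(r)\}$. Each type $b$ has capacity $s_b\in\mathbb Z_{\ge1}$, with $\mathcal S_b=\{0,\dots,s_b\}$, $\mathcal S_b^w=\{1,\dots,s_b\}$, $\mathcal S_b^z=\{0,\dots,s_b-1\}$. Charging durations $\kappa_{rbis}\in\mathbb Z_{\ge1}$, fast-charger throughput $\rho\in\mathbb Z_{\ge1}$, service requirements $d_r^{pt}\in\mathbb Z_+$, charger capacities $\bar\chi_i^{\mathrm{UB}},\widetilde\chi_j^{\mathrm{UB}}\in\mathbb Z_+$, budgets $I_p^{\mathrm{UB}}$, targets $\eta_p^{\mathrm{LB}},\widehat\eta_p^{\mathrm{UB}}$, initial state $x_0$, and operational cost vectors $c^y_{pr}\ge0$. **Strategic feasible set.** The state in period $p$ is $x_p=(\chi_p,\{\eta_{pr}\}_{r\in\mathcal R})\in\mathbb Z_+^n$ with $\chi_p=(\bar\chi^p,\widetilde\chi^p)\in\mathbb Z_+^{\mathcal I}\times\mathbb Z_+^{\mathcal J}$ (numbers of depot and on-route chargers) and $\eta_{pr}=(\bar\eta^p_r,\widetilde\eta^p_r,\widehat\eta^p_r)\in\mathbb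 Z_+^{\mathcal B}\times\mathbb Z_+\times\mathbb Z_+$ (depot BEBs by type, on-route BEBs, conventional buses assigned to route $r$). $\mathcal X$ is the set of $x=(x_p)_{p\in\mathcal P}$ satisfying, for all $p\in\mathcal P$ (and all relevant $i,j,b$): $I_p(x_p-x_{p-1})\le I_p^{\mathrm{UB}}$, where $I_p$ (investment cost) depends linearly on the number of each type of assets acquired and sold; $\bar\chi_i^p\ge\bar\chi_i^{p-1}$, $\widetilde\chi_j^p\ge\widetilde\chi_j^{p-1}$; $\sum_r\bar\eta^p_{rb}\ge\sum_r\bar\eta^{p-1}_{rb}$, $\sum_r\widetilde\eta_r^p\ge\sum_r\widetilde\eta_r^{p-1}$, $\sum_r\widehat\eta_r^p\le\sum_r\widehat\eta_r^{p-1}$; $\sum_r\sum_b\bar\eta_{rb}^p+\sum_r\widetilde\eta_r^p\ge\eta_p^{\mathrm{LB}}$, $\sum_r\widehat\eta_r^p\le\widehat\eta_p^{\mathrm{UB}}$; $\bar\chi_i^p\le\bar\chi_i^{\mathrm{UB}}$, $\widetilde\chi_j^p\le\widetilde\chi_j^{\mathrm{UB}}$. $\mathcal X_p$ is the projection of $\mathcal X$ onto the variables $x_p$. **Operational problem.** For $x_p\in\mathcal X_p$, $\mathcal Q_p(x_p)$ is the optimal value ($+\infty$ if infeasible) of minimizing $\sum_{r\in\mathcal R}(c^y_{pr})^\top y_{pr}$ over nonnegative integer vectors $y_{pr}=(w^p_r,v^p_r,z^p_r,\widetilde w^p_r,\widehat w^p_r)$ with components $w^{pt}_{rbs}$ ($s\in\mathcal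 S_b^w$), $v^{pt}_{rbs}$ ($s\in\mathcal S_b$), $z^{pt}_{rbis}$ ($s\in\mathcal S_b^z$), $\widetilde w^{pt}_{rj}$ ($j\in\mathcal J(r)$), $\widehat w^{pt}_r$, subject to, for all $t\in\mathcal T$: - $\sum_{b}\sum_{r}\sum_{s\in\mathcal S_b^z}\sum_{l=0}^{\kappa_{rbis}-1}z_{rbis}^{p(t-l)}\le\bar\chi_i^p$ for all $i\in\mathcal I$; - $\sum_{r\in\mathcal R(j)}\widetilde w_{rj}^{pt}\le\rho\,\widetilde\chi_j^p$ for all $j\in\mathcal J$; - $\sum_b\sum_{s\in\mathcal S_b^w}w_{rbs}^{pt}+\sum_{j\in\mathcal J(r)}\widetilde w_{rj}^{pt}+\widehat w_r^{pt}\ge d_r^{pt}$ for all $r$; - for all $r,b$: $v_{rbs}^{pt}+w_{rbs}^{pt}=v_{rbs}^{p(t-1)}+\sum_i\sum_{s'\in\mathcal S_b^z}z_{rbis'}^{p(t-\kappa_{rbis'})}$ for $s=s_b$; $v_{rbs}^{pt}+w_{rbs}^{pt}+\sum_i z_{rbis}^{pt}=v_{rbs}^{p(t-1)}+w_{rb(s+1)}^{p(t-1)}$ for $0<s<s_b$; $v_{rbs}^{pt}+\sum_i z_{rbis}^{pt}=v_{rbs}^{p(t-1)}+w_{rb(s+1)}^{p(t-1)}$ for $s=0$; - $\sum_{s\in\mathcal S_b}v_{rbs}^{p0}+\sum_{s\in\mathcal S_b^w}w_{rbs}^{p0}+\sum_i\sum_{s\in\mathcal S_b^z}\sum_{l=0}^{\kappa_{rbis}-1}z_{rbis}^{p(-l)}\le\bar\eta_{rb}^p$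 for all $r,b$; - $\sum_{j\in\mathcal J(r)}\widetilde w_{rj}^{pt}\le\widetilde\eta_r^p$ and $\widehat w_r^{pt}\le\widehat\eta_r^p$ for all $r$. **Notation.** $\preceq$ denotes componentwise inequality of vectors, and $\mathbf 1\{x_p\preceq x'_p\}$ equals $1$ if $x_p\preceq x'_p$ and $0$ otherwise. *)

theory Defs
  imports "HOL-Library.Extended_Real" "HOL-Library.FuncSet"
begin

(* Strategic vectors: chargers per depot / terminal, and buses per route
   (depot BEBs also by type).  With values in nat these are states; with values
   in int they are differences of states. *)
record ('r, 'b, 'i, 'j, 'n) fleet =
  depot_chargers   :: "'i \<Rightarrow> 'n"
  onroute_chargers :: "'j \<Rightarrow> 'n"
  depot_bebs       :: "'r \<Rightarrow> 'b \<Rightarrow> 'n"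
  onroute_bebs     :: "'r \<Rightarrow> 'n"
  conv_buses       :: "'r \<Rightarrow> 'n"

type_synonym ('r, 'b, 'i, 'j) state = "('r, 'b, 'i, 'j, nat) fleet"

(* Operational vectors of one route, with components w, v, z, w-tilde, w-hat;
   the first argument is the time interval, state-of-charge levels come last.
   With values in nat these are decisions, with values in real cost vectors. *)
record ('b, 'i, 'j, 'n) route_ops =
  dep_serve  :: "nat \<Rightarrow> 'b \<Rightarrow> nat \<Rightarrow> 'n"
  dep_idle   :: "nat \<Rightarrow> 'b \<Rightarrow> nat \<Rightarrow> 'n"
  dep_charge :: "nat \<Rightarrow> 'b \<Rightarrow> 'i \<Rightarrow> nat \<Rightarrow> 'n"
  onr_serve  :: "nat \<Rightarrow> 'j \<Rightarrow> 'n"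
  conv_serve :: "nat \<Rightarrow> 'n"

(* Unit costs per asset type, for one period and one direction (acquisition or
   sale).  Buses can be reassigned between routes, so their unit cost does not
   depend on the route. *)
record ('b, 'i, 'j) unit_costs =
  uc_depot_charger   :: "'i \<Rightarrow> real"
  uc_onroute_charger :: "'j \<Rightarrow> real"
  uc_depot_beb       :: "'b \<Rightarrow> real"
  uc_onroute_beb     :: real
  uc_conv            :: real

record ('r, 'b, 'i, 'j) bfe_data =
  num_periods   :: nat
  num_times     :: nat
  routes        :: "'r set"
  beb_types     :: "'b set"
  depots        :: "'i set"
  terminals     :: "'j set"
  route_terminals :: "'r \<Rightarrow> 'j set"
  capacity      :: "'b \<Rightarrow> nat"
  charge_time   :: "'r \<Rightarrow> 'b \<Rightarrow> 'i \<Rightarrow> nat \<Rightarrow> nat"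
  throughput    :: nat
  demand        :: "'r \<Rightarrow> nat \<Rightarrow> nat \<Rightarrow> nat"
  depot_charger_ub   :: "'i \<Rightarrow> nat"
  onroute_charger_ub :: "'j \<Rightarrow> nat"
  budget        :: "nat \<Rightarrow> real"
  beb_target_lb :: "nat \<Rightarrow> real"
  conv_target_ub :: "nat \<Rightarrow> real"
  initial_state :: "('r, 'b, 'i, 'j) state"
  buy_cost      :: "nat \<Rightarrow> ('b, 'i, 'j) unit_costs"
  sell_cost     :: "nat \<Rightarrow> ('b, 'i, 'j) unit_costs"
  op_cost       :: "nat \<Rightarrow> 'r \<Rightarrow> ('b, 'i, 'j, real) route_ops"

definition periods :: "('r, 'b, 'i, 'j) bfe_data \<Rightarrow> nat set" where
  "periods D = {1..num_periods D}"

definition times :: "('r, 'b, 'i, 'j) bfe_data \<Rightarrow> nat set" where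
  "times D = {0..<num_times D}"

definition S_all :: "('r, 'b, 'i, 'j) bfe_data \<Rightarrow> 'b \<Rightarrow> nat set" where
  "S_all D b = {0..capacity D b}"

definition S_w :: "('r, 'b, 'i, 'j) bfe_data \<Rightarrow> 'b \<Rightarrow> nat set" where
  "S_w D b = {1..capacity D b}"

definition S_z :: "('r, 'b, 'i, 'j) bfe_data \<Rightarrow> 'b \<Rightarrow> nat set" where
  "S_z D b = {0..<capacity D b}"

definition terminal_routes :: "('r, 'b, 'i, 'j) bfe_data \<Rightarrow> 'j \<Rightarrow> 'r set" where
  "terminal_routes D j = {r \<in> routes D. j \<in> route_terminals D r}"

(* The representative in {0..<T} of t - l modulo T. *)
definition time_minus :: "('r, 'b, 'i, 'j) bfe_data \<Rightarrow> nat \<Rightarrow> nat \<Rightarrow> nat" where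
  "time_minus D t l = nat ((int t - int l) mod int (num_times D))"

(* Functions are extensional, so that a state is determined by its components
   with indices in the given finite sets. *)
definition state_space :: "('r, 'b, 'i, 'j) bfe_data \<Rightarrow> ('r, 'b, 'i, 'j) state set" where
  "state_space D = {x.
     depot_chargers x \<in> depots D \<rightarrow>\<^sub>E UNIV \<and>
     onroute_chargers x \<in> terminals D \<rightarrow>\<^sub>E UNIV \<and>
     depot_bebs x \<in> routes D \<rightarrow>\<^sub>E (beb_types D \<rightarrow>\<^sub>E UNIV) \<and>
     onroute_bebs x \<in> routes D \<rightarrow>\<^sub>E UNIV \<and>
     conv_buses x \<in> routes D \<rightarrow>\<^sub>E UNIV}"

definition nonneg_ops ::
  "('r, 'b, 'i, 'j) bfe_data \<Rightarrow> 'r \<Rightarrow> ('b, 'i, 'j, real) route_ops \<Rightarrow> bool" where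
  "nonneg_ops D r c \<longleftrightarrow> (\<forall>t\<in>times D.
     (\<forall>b\<in>beb_types D. \<forall>s\<in>S_w D b. 0 \<le> dep_serve c t b s) \<and>
     (\<forall>b\<in>beb_types D. \<forall>s\<in>S_all D b. 0 \<le> dep_idle c t b s) \<and>
     (\<forall>b\<in>beb_types D. \<forall>i\<in>depots D. \<forall>s\<in>S_z D b. 0 \<le> dep_charge c t b i s) \<and>
     (\<forall>j\<in>route_terminals D r. 0 \<le> onr_serve c t j) \<and>
     0 \<le> conv_serve c t)"

definition bfe_instance :: "('r, 'b, 'i, 'j) bfe_data \<Rightarrow> bool" where
  "bfe_instance D \<longleftrightarrow>
     1 \<le> num_times D \<and>
     finite (routes D) \<and> finite (beb_types D) \<and> finite (depots D) \<and> finite (terminals D) \<and>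
     (\<forall>r\<in>routes D. route_terminals D r \<subseteq> terminals D) \<and>
     (\<forall>b\<in>beb_types D. 1 \<le> capacity D b) \<and>
     (\<forall>r\<in>routes D. \<forall>b\<in>beb_types D. \<forall>i\<in>depots D. \<forall>s\<in>S_z D b. 1 \<le> charge_time D r b i s) \<and>
     1 \<le> throughput D \<and>
     initial_state D \<in> state_space D \<and>
     (\<forall>p\<in>periods D. \<forall>r\<in>routes D. nonneg_ops D r (op_cost D p r))"

definition state_diff ::
  "('r, 'b, 'i, 'j) state \<Rightarrow> ('r, 'b, 'i, 'j) state \<Rightarrow> ('r, 'b, 'i, 'j, int) fleet" where
  "state_diff x x' = \<lparr>
     depot_chargers = (\<lambda>i. int (depot_chargers x i) - int (depot_chargers x' i)),
     onroute_chargers = (\<lambda>j. int (onroute_chargers x j) - int (onroute_chargers x' j)),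
     depot_bebs = (\<lambda>r b. int (depot_bebs x r b) - int (depot_bebs x' r b)),
     onroute_bebs = (\<lambda>r. int (onroute_bebs x r) - int (onroute_bebs x' r)),
     conv_buses = (\<lambda>r. int (conv_buses x r) - int (conv_buses x' r))\<rparr>"

(* Cost of a net change k of one asset type: the number acquired is the positive
   part of k, the number sold its negative part.  A sale revenue is a negative
   unit cost a'. *)
definition trade_cost :: "real \<Rightarrow> real \<Rightarrow> int \<Rightarrow> real" where
  "trade_cost a a' k = a * of_int (max k 0) + a' * of_int (max (- k) 0)"

definition investment_cost ::
  "('r, 'b, 'i, 'j) bfe_data \<Rightarrow> nat \<Rightarrow> ('r, 'b, 'i, 'j, int) fleet \<Rightarrow> real" where
  "investment_cost D p \<delta> = (let a = buy_cost D p; a' = sell_cost D p in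
     (\<Sum>i\<in>depots D. trade_cost (uc_depot_charger a i) (uc_depot_charger a' i) (depot_chargers \<delta> i)) +
     (\<Sum>j\<in>terminals D.
        trade_cost (uc_onroute_charger a j) (uc_onroute_charger a' j) (onroute_chargers \<delta> j)) +
     (\<Sum>b\<in>beb_types D.
        trade_cost (uc_depot_beb a b) (uc_depot_beb a' b) (\<Sum>r\<in>routes D. depot_bebs \<delta> r b)) +
     trade_cost (uc_onroute_beb a) (uc_onroute_beb a') (\<Sum>r\<in>routes D. onroute_bebs \<delta> r) +
     trade_cost (uc_conv a) (uc_conv a') (\<Sum>r\<in>routes D. conv_buses \<delta> r))"

definition strategic_step ::
  "('r, 'b, 'i, 'j) bfe_data \<Rightarrow> nat \<Rightarrow> ('r, 'b, 'i, 'j) state \<Rightarrow> ('r, 'b, 'i, 'j) state \<Rightarrow> bool"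
where
  "strategic_step D p x' x \<longleftrightarrow>
     investment_cost D p (state_diff x x') \<le> budget D p \<and>
     (\<forall>i\<in>depots D. depot_chargers x' i \<le> depot_chargers x i) \<and>
     (\<forall>j\<in>terminals D. onroute_chargers x' j \<le> onroute_chargers x j) \<and>
     (\<forall>b\<in>beb_types D. (\<Sum>r\<in>routes D. depot_bebs x' r b) \<le> (\<Sum>r\<in>routes D. depot_bebs x r b)) \<and>
     (\<Sum>r\<in>routes D. onroute_bebs x' r) \<le> (\<Sum>r\<in>routes D. onroute_bebs x r) \<and>
     (\<Sum>r\<in>routes D. conv_buses x r) \<le> (\<Sum>r\<in>routes D. conv_buses x' r) \<and>
     beb_target_lb D p \<le>
       real ((\<Sum>r\<in>routes D. \<Sum>b\<in>beb_types D. depot_bebs x r b) + (\<Sum>r\<in>routes D. onroute_bebs x r)) \<and>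
     real (\<Sum>r\<in>routes D. conv_buses x r) \<le> conv_target_ub D p \<and>
     (\<forall>i\<in>depots D. depot_chargers x i \<le> depot_charger_ub D i) \<and>
     (\<forall>j\<in>terminals D. onroute_chargers x j \<le> onroute_charger_ub D j)"

definition strategic_set ::
  "('r, 'b, 'i, 'j) bfe_data \<Rightarrow> (nat \<Rightarrow> ('r, 'b, 'i, 'j) state) set" where
  "strategic_set D = {x \<in> periods D \<rightarrow>\<^sub>E state_space D.
     \<forall>p\<in>periods D. strategic_step D p (if p = 1 then initial_state D else x (p - 1)) (x p)}"

definition period_set ::
  "('r, 'b, 'i, 'j) bfe_data \<Rightarrow> nat \<Rightarrow> ('r, 'b, 'i, 'j) state set" where
  "period_set D p = (\<lambda>x. x p) ` strategic_set D"

definition op_feasible ::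
  "('r, 'b, 'i, 'j) bfe_data \<Rightarrow> nat \<Rightarrow> ('r, 'b, 'i, 'j) state \<Rightarrow>
     ('r \<Rightarrow> ('b, 'i, 'j, nat) route_ops) set" where
  "op_feasible D p x = {y.
     (\<forall>t\<in>times D.
       (\<forall>i\<in>depots D.
         (\<Sum>b\<in>beb_types D. \<Sum>r\<in>routes D. \<Sum>s\<in>S_z D b. \<Sum>l<charge_time D r b i s.
            dep_charge (y r) (time_minus D t l) b i s) \<le> depot_chargers x i) \<and>
       (\<forall>j\<in>terminals D.
         (\<Sum>r\<in>terminal_routes D j. onr_serve (y r) t j) \<le> throughput D * onroute_chargers x j) \<and>
       (\<forall>r\<in>routes D.
         demand D r p t \<le>
           (\<Sum>b\<in>beb_types D. \<Sum>s\<in>S_w D b. dep_serve (y r) t b s) +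
           (\<Sum>j\<in>route_terminals D r. onr_serve (y r) t j) + conv_serve (y r) t) \<and>
       (\<forall>r\<in>routes D. \<forall>b\<in>beb_types D.
         dep_idle (y r) t b (capacity D b) + dep_serve (y r) t b (capacity D b) =
           dep_idle (y r) (time_minus D t 1) b (capacity D b) +
           (\<Sum>i\<in>depots D. \<Sum>s\<in>S_z D b. dep_charge (y r) (time_minus D t (charge_time D r b i s)) b i s)) \<and>
       (\<forall>r\<in>routes D. \<forall>b\<in>beb_types D. \<forall>s\<in>{0<..<capacity D b}.
         dep_idle (y r) t b s + dep_serve (y r) t b s + (\<Sum>i\<in>depots D. dep_charge (y r) t b i s) =
           dep_idle (y r) (time_minus D t 1) b s + dep_serve (y r) (time_minus D t 1) b (s + 1)) \<and>
       (\<forall>r\<in>routes D. \<forall>b\<in>beb_types D.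
         dep_idle (y r) t b 0 + (\<Sum>i\<in>depots D. dep_charge (y r) t b i 0) =
           dep_idle (y r) (time_minus D t 1) b 0 + dep_serve (y r) (time_minus D t 1) b 1) \<and>
       (\<forall>r\<in>routes D. (\<Sum>j\<in>route_terminals D r. onr_serve (y r) t j) \<le> onroute_bebs x r) \<and>
       (\<forall>r\<in>routes D. conv_serve (y r) t \<le> conv_buses x r)) \<and>
     (\<forall>r\<in>routes D. \<forall>b\<in>beb_types D.
       (\<Sum>s\<in>S_all D b. dep_idle (y r) 0 b s) + (\<Sum>s\<in>S_w D b. dep_serve (y r) 0 b s) +
       (\<Sum>i\<in>depots D. \<Sum>s\<in>S_z D b. \<Sum>l<charge_time D r b i s.
          dep_charge (y r) (time_minus D 0 l) b i s) \<le> depot_bebs x r b)}"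

definition ops_dot ::
  "('r, 'b, 'i, 'j) bfe_data \<Rightarrow> 'r \<Rightarrow> ('b, 'i, 'j, real) route_ops \<Rightarrow>
     ('b, 'i, 'j, nat) route_ops \<Rightarrow> real" where
  "ops_dot D r c y = (\<Sum>t\<in>times D.
     (\<Sum>b\<in>beb_types D. \<Sum>s\<in>S_w D b. dep_serve c t b s * real (dep_serve y t b s)) +
     (\<Sum>b\<in>beb_types D. \<Sum>s\<in>S_all D b. dep_idle c t b s * real (dep_idle y t b s)) +
     (\<Sum>b\<in>beb_types D. \<Sum>i\<in>depots D. \<Sum>s\<in>S_z D b.
        dep_charge c t b i s * real (dep_charge y t b i s)) +
     (\<Sum>j\<in>route_terminals D r. onr_serve c t j * real (onr_serve y t j)) +
     conv_serve c t * real (conv_serve y t))"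

(* The infimum over the empty set is \<infinity>.  Otherwise the infimum is a minimum:
   a nonnegative linear function attains its infimum on every nonempty set of
   nonnegative integer vectors (finitely many minimal elements, by Dickson). *)
definition op_value ::
  "('r, 'b, 'i, 'j) bfe_data \<Rightarrow> nat \<Rightarrow> ('r, 'b, 'i, 'j) state \<Rightarrow> ereal" where
  "op_value D p x =
     (INF y\<in>op_feasible D p x. ereal (\<Sum>r\<in>routes D. ops_dot D r (op_cost D p r) (y r)))"

definition state_le ::
  "('r, 'b, 'i, 'j) bfe_data \<Rightarrow> ('r, 'b, 'i, 'j) state \<Rightarrow> ('r, 'b, 'i, 'j) state \<Rightarrow> bool" where
  "state_le D x x' \<longleftrightarrow>
     (\<forall>i\<in>depots D. depot_chargers x i \<le> depot_chargers x' i) \<and>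
     (\<forall>j\<in>terminals D. onroute_chargers x j \<le> onroute_chargers x' j) \<and>
     (\<forall>r\<in>routes D. \<forall>b\<in>beb_types D. depot_bebs x r b \<le> depot_bebs x' r b) \<and>
     (\<forall>r\<in>routes D. onroute_bebs x r \<le> onroute_bebs x' r) \<and>
     (\<forall>r\<in>routes D. conv_buses x r \<le> conv_buses x' r)"

definition LBBD ::
  "('r, 'b, 'i, 'j) bfe_data \<Rightarrow> nat \<Rightarrow> (('r, 'b, 'i, 'j) state \<times> real) set" where
  "LBBD D p = {(x, \<Theta>). x \<in> period_set D p \<and> 0 \<le> \<Theta> \<and>
     (\<forall>x'\<in>period_set D p. op_value D p x' < \<infinity> \<longrightarrow>
        op_value D p x' * of_bool (state_le D x x') \<le> ereal \<Theta>) \<and>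
     (\<forall>x'\<in>period_set D p. op_value D p x' = \<infinity> \<longrightarrow>
        (of_bool (state_le D x x') :: ereal) = 0)}"

definition epi :: "'x set \<Rightarrow> ('x \<Rightarrow> ereal) \<Rightarrow> ('x \<times> real) set" where
  "epi X f = {(x, \<Theta>). x \<in> X \<and> 0 \<le> \<Theta> \<and> f x \<le> ereal \<Theta>}"

end

theory Submission
  imports Defs
begin

(* Feasible operations stay feasible when assets are added, so op_value is
   antitone in the state.  Hence the strongest of the cuts at x is the one
   generated by x itself, which is the epigraph inequality. *)

lemma state_le_refl: "state_le D x x"
  by (simp add: state_le_def)

text \<open>The state enters the constraints only through upper bounds; demand and flow balance do
  not involve it.\<close>

lemma op_feasible_mono:
  assumes "state_le D x x'"
  shows "op_feasible D p x \<subseteq> op_feasible D p x'"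
proof -
  \<comment> \<open>This bound is a multiple of a state component, so \<open>state_le\<close> does
    not chain with it directly.\<close>
  have "throughput D * onroute_chargers x j \<le> throughput D * onroute_chargers x' j"
    if "j \<in> terminals D" for j
    using assms that by (simp add: state_le_def)
  then show ?thesis
    using assms unfolding op_feasible_def state_le_def ball_conj_distrib
    by (intro Collect_mono impI, elim conjE, intro conjI) (assumption | meson order_trans)+
qed

lemma op_value_antimono:
  assumes "state_le D x x'"
  shows "op_value D p x' \<le> op_value D p x"
  unfolding op_value_def by (intro INF_superset_mono op_feasible_mono assms order_refl)

theorem proposition2:
  fixes D :: "('r, 'b, 'i, 'j) bfe_data" and p :: nat
  assumes "bfe_instance D" and "p \<in> periods D"
  shows "LBBD D p = epi (period_set D p) (op_value D p)"
proof (intro set_eqI iffI)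
  fix z
  assume "z \<in> LBBD D p"
  then obtain x \<Theta> where z: "z = (x, \<Theta>)" and x: "x \<in> period_set D p" "0 \<le> \<Theta>"
    and fin: "op_value D p x < \<infinity> \<Longrightarrow> op_value D p x * of_bool (state_le D x x) \<le> ereal \<Theta>"
    and inf: "op_value D p x = \<infinity> \<Longrightarrow> (of_bool (state_le D x x) :: ereal) = 0"
    by (auto simp: LBBD_def)
  \<comment> \<open>An infinite value at \<open>x\<close> would force the indicator of
    \<open>x\<close> against itself, which is 1, to be 0.\<close>
  have "op_value D p x < \<infinity>"
    using inf by (auto simp: state_le_refl less_top)
  with fin z x show "z \<in> epi (period_set D p) (op_value D p)"
    by (simp add: epi_def state_le_refl)
next
  fix z
  assume "z \<in> epi (period_set D p) (op_value D p)"
  then obtain x \<Theta> where z: "z = (x, \<Theta>)" and x: "x \<in> period_set D p" "0 \<le> \<Theta>"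
    and le: "op_value D p x \<le> ereal \<Theta>"
    by (auto simp: epi_def)
  \<comment> \<open>As \<Theta> is real, this also rules out infinite values above \<open>x\<close>.
    For all other \<open>x'\<close> the indicator is 0 and the cut reads
    \<open>0 \<le> \<Theta>\<close>.\<close>
  have "op_value D p x' \<le> ereal \<Theta>" if "state_le D x x'" for x'
    using op_value_antimono[OF that] le by (rule order_trans)
  with z x show "z \<in> LBBD D p"
    by (fastforce simp: LBBD_def of_bool_def)
qed

end
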